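(* Let $\mu\equiv 1_{3\times3}$ and let $\varepsilon\in C^1(\mathbb{R}\times\mathbb{R}^3;\mathbb{R}^{3\times3}_{\mathrm{sym}})$ satisfy $\lambda|v|^2\le v\cdot\varepsilon(x)v\le\Lambda|v|^2$ for all $v\in\mathbb{R}^3$, $x\in\mathbb{R}^4$ with some constants $\lambda,\Lambda>0$. Let $\varepsilon_1(x),\varepsilon_2(x),\varepsilon_3(x)$ denote the eigenvalues of $\varepsilon(x)$ and suppose that $$\exists c>0\ \forall x\in\mathbb{R}^4:\quad |\varepsilon_i(x)-\varepsilon_j(x)|\ge c\quad\text{for } i\neq j.$$ Then $(\varepsilon,\mu)$ satisfies the following: there exist $\Phi\in C^1(\mathbb{R}\times\mathbb{R}^3;\mathbb{R}^{3\times3})$ with $\Phi^t(x)\Phi(x)=1_{3\times3}$ for all $x$, and diagonal matrix functions $\varepsilon^d=\mathrm{diag}(\varepsilon^1,\varepsilon^2,\varepsilon^3)$, $\mu^d=\mathrm{diag}(\mu^1,\mu^2,\mu^3)$ in $C(\mathbb{R}\times\mathbb{R}^3;\mathbb{R}^{3\times3})$ such that $$\varepsilon^d=\Phi^t\varepsilon\Phi,\qquad \mu^d=\Phi^t\mu\Phi,\qquad \exists c'>0\ \forall x\in\mathbb{R}^4\ \forall i\neq j:\ \Big|\frac{\varepsilon^i(x)}{\mu^i(x)}-\frac{\varepsilon^j(x)}{\mu^j(x)}\Big|\ge c'.$$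
   Context: $\mathbb{R}^{3\times3}_{\mathrm{sym}}$ denotes the real symmetric $3\times3$ matrices. *)

theory Defs
  imports "HOL-Analysis.Analysis"
begin

type_synonym spacetime = "real \<times> (real ^ 3)"

text \<open>
  Class \<open>C\<^sup>1\<close> on the whole space: Frechet differentiable everywhere, with the derivative
  continuous in the operator norm.
\<close>
definition C1 :: "('a::real_normed_vector \<Rightarrow> 'b::real_normed_vector) \<Rightarrow> bool" where
  "C1 f \<longleftrightarrow> (\<exists>f' :: 'a \<Rightarrow> 'a \<Rightarrow>\<^sub>L 'b.
     (\<forall>x. (f has_derivative blinfun_apply (f' x)) (at x)) \<and> continuous_on UNIV f')"

definition diag_matrix :: "('n \<Rightarrow> real) \<Rightarrow> real ^ 'n ^ 'n" where
  "diag_matrix d = (\<chi> i j. if i = j then d i else 0)"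

definition eigenspace :: "real ^ 'n ^ 'n \<Rightarrow> real \<Rightarrow> (real ^ 'n) set" where
  "eigenspace A l = {v. A *v v = l *\<^sub>R v}"

text \<open>
  The family \<open>e\<close> lists the (real) eigenvalues of \<open>A\<close> with multiplicity: every real \<open>l\<close> occurs
  exactly as often as the dimension of its eigenspace, in particular not at all if it is not an
  eigenvalue.  The multiplicity is the geometric one, which for symmetric \<open>A\<close> is also the
  algebraic one.  The order of the list is arbitrary.
\<close>
definition lists_eigenvalues :: "('n::finite \<Rightarrow> real) \<Rightarrow> real ^ 'n ^ 'n \<Rightarrow> bool" where
  "lists_eigenvalues e A \<longleftrightarrow> (\<forall>l. card {i. e i = l} = dim (eigenspace A l))"

end

theory Submission
  imports Defs
begin

text \<open>
  The frame \<open>\<Phi>\<close> has to consist of unit eigenvectors, so two choices have to be made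
  coherently over the whole domain: the order of the eigenvalues and the signs of the eigenvectors.

  \<^item> Order: at each point the eigenvalues are sorted increasingly.  A small symmetric perturbation
    \<open>B\<close> of \<open>A\<close> has an eigenvalue close to every eigenvalue of \<open>A\<close>
    (\<open>eigenframe_residual\<close>).  As the eigenvalues of \<open>A\<close> are distinct, this assignment is strictly
    increasing in the index, hence the identity (\<open>strict_mono_finite_id\<close>).  So the sorted
    eigenvalues are continuous.

  \<^item> Signs: the identity
    \<open>(l\<^sub>i(x) - l\<^sub>j(y)) (u\<^sub>j(y) \<bullet> u\<^sub>i(x)) = u\<^sub>j(y) \<bullet> (A(x) - A(y)) u\<^sub>i(x)\<close>
    (\<open>eigenframe_overlap\<close>) shows that, whatever the signs, the overlaps with \<open>j \<noteq> i\<close> vanish as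
    \<open>x \<rightarrow> y\<close>, so the eigenlines vary continuously.  The unit vectors on a continuous line field form
    a two-sheeted covering of the domain, which has a global section because the domain is simply
    connected (\<open>unit_line_field_lift\<close>).  This gives continuous eigenvectors \<open>u\<^sub>i\<close>.

  \<^item> Smoothness: once \<open>u\<^sub>i\<close> and \<open>l\<^sub>i\<close> are continuous, the same identity is a difference quotient in
    disguise.  The factor \<open>A(x) - A(y)\<close> vanishes at \<open>x = y\<close> and is differentiable there, so
    continuity of the other factor suffices, and
    \<open>u\<^sub>i'(x) h = \<Sum>\<^sub>j\<^sub>\<noteq>\<^sub>i (u\<^sub>j \<bullet> (A'(x) h) u\<^sub>i) / (l\<^sub>i - l\<^sub>j) u\<^sub>j\<close>.
    All terms on the right are continuous, so \<open>u\<^sub>i\<close> is \<open>C\<^sup>1\<close>.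

  With \<open>\<mu> = 1\<close> one has \<open>\<Phi>\<^sup>t \<mu> \<Phi> = 1\<close>, and the gap of the ratios is the gap of the eigenvalues.
\<close>

section \<open>Orthonormal eigenbases of a single matrix\<close>

definition eigenframe :: "real ^ 'n::finite ^ 'n \<Rightarrow> ('n \<Rightarrow> real) \<Rightarrow> ('n \<Rightarrow> real ^ 'n) \<Rightarrow> bool" where
  "eigenframe A l u \<longleftrightarrow>
     (\<forall>i j. u i \<bullet> u j = (if i = j then 1 else 0)) \<and> (\<forall>i. A *v u i = l i *\<^sub>R u i)"

lemma eigenframe_inner_frame: "eigenframe A l u \<Longrightarrow> u i \<bullet> u j = (if i = j then 1 else 0)"
  by (simp add: eigenframe_def)

lemma eigenframe_eigen: "eigenframe A l u \<Longrightarrow> A *v u i = l i *\<^sub>R u i"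
  by (simp add: eigenframe_def)

lemma eigenframe_norm: "eigenframe A l u \<Longrightarrow> norm (u i) = 1"
  by (simp add: eigenframe_def norm_eq_1)

text \<open>
  An orthonormal family indexed by the coordinates has an orthogonal matrix as its matrix of rows,
  and a right inverse of a square matrix is a left inverse; applying both matrices to \<open>v\<close> is the
  expansion.
\<close>

lemma eigenframe_expand:
  fixes A :: "real ^ 'n ^ 'n"
  assumes "eigenframe A l u"
  shows "v = (\<Sum>i\<in>UNIV. (u i \<bullet> v) *\<^sub>R u i)"
proof -
  let ?M = "(\<chi> i. u i) :: real ^ 'n ^ 'n"
  have "?M ** transpose ?M = mat 1"
    using assms
    by (simp add: eigenframe_def matrix_matrix_mult_def transpose_def mat_def vec_eq_iff inner_vec_def)
  then have "transpose ?M ** ?M = mat 1"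
    by (simp add: matrix_left_right_inverse)
  then have "v = transpose ?M *v (?M *v v)"
    by (simp add: matrix_vector_mul_assoc)
  also have "\<dots> = (\<Sum>i\<in>UNIV. (u i \<bullet> v) *\<^sub>R u i)"
    by (simp add: vec_eq_iff matrix_vector_mult_def transpose_def inner_vec_def mult.commute)
  finally show ?thesis .
qed

lemma eigenframe_parseval:
  assumes "eigenframe A l u"
  shows "(norm v)\<^sup>2 = (\<Sum>i\<in>UNIV. (u i \<bullet> v)\<^sup>2)"
proof -
  have "(norm v)\<^sup>2 = v \<bullet> (\<Sum>i\<in>UNIV. (u i \<bullet> v) *\<^sub>R u i)"
    using eigenframe_expand[OF assms, of v] by (simp add: power2_norm_eq_inner)
  then show ?thesis
    by (simp add: inner_sum_right power2_eq_square inner_commute)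
qed

text \<open>
  A matrix with an orthonormal eigenbasis is self-adjoint, so it can be moved to the eigenvector.
\<close>

lemma eigenframe_inner_apply:
  assumes "eigenframe A l u"
  shows "u i \<bullet> (A *v v) = l i * (u i \<bullet> v)"
proof -
  have "A *v v = (\<Sum>j\<in>UNIV. (u j \<bullet> v) *\<^sub>R (A *v u j))"
    by (subst eigenframe_expand[OF assms, of v])
      (simp add: linear_sum linear_cmul)
  also have "\<dots> = (\<Sum>j\<in>UNIV. (u j \<bullet> v) *\<^sub>R (l j *\<^sub>R u j))"
    using assms by (simp add: eigenframe_eigen)
  finally show ?thesis
    using assms by (simp add: inner_sum_right eigenframe_inner_frame if_distrib cong: if_cong)
qed

text \<open>
  In the eigenbasis, \<open>A v - t v\<close> has the coordinates \<open>(l i - t) (u i \<bullet> v)\<close>.  If every \<open>\<bar>l i - t\<bar>\<close>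
  exceeded the norm of this vector, Parseval's identity would make the norm exceed itself.
\<close>

lemma eigenframe_residual:
  assumes fr: "eigenframe A l u" and v: "norm v = 1"
  shows "\<exists>i. \<bar>l i - t\<bar> \<le> norm (A *v v - t *\<^sub>R v)"
proof (rule ccontr)
  let ?r = "norm (A *v v - t *\<^sub>R v)"
  assume "\<not> ?thesis"
  then have less: "?r < \<bar>l i - t\<bar>" for i by (simp add: not_le)
  have sq: "?r\<^sup>2 < (l i - t)\<^sup>2" for i
    using power_strict_mono[OF less[of i], of 2] by simp
  have one: "(\<Sum>i\<in>UNIV. (u i \<bullet> v)\<^sup>2) = 1"
    using eigenframe_parseval[OF fr, of v] v by simp
  then obtain k where "(u k \<bullet> v)\<^sup>2 \<noteq> 0"
    using sum.neutral zero_neq_one by metis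
  then have k: "(u k \<bullet> v)\<^sup>2 > 0" by simp
  have "?r\<^sup>2 = (\<Sum>i\<in>UNIV. (u i \<bullet> (A *v v - t *\<^sub>R v))\<^sup>2)"
    by (rule eigenframe_parseval[OF fr])
  also have "\<dots> = (\<Sum>i\<in>UNIV. (l i - t)\<^sup>2 * (u i \<bullet> v)\<^sup>2)"
    by (simp add: inner_diff_right eigenframe_inner_apply[OF fr] left_diff_distrib[symmetric] power_mult_distrib)
  also have "\<dots> > (\<Sum>i\<in>UNIV. ?r\<^sup>2 * (u i \<bullet> v)\<^sup>2)"
  proof (rule sum_strict_mono_ex1)
    show "\<forall>i\<in>UNIV. ?r\<^sup>2 * (u i \<bullet> v)\<^sup>2 \<le> (l i - t)\<^sup>2 * (u i \<bullet> v)\<^sup>2"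
      using sq by (intro ballI mult_right_mono) (auto intro: less_imp_le)
    show "\<exists>i\<in>UNIV. ?r\<^sup>2 * (u i \<bullet> v)\<^sup>2 < (l i - t)\<^sup>2 * (u i \<bullet> v)\<^sup>2"
      using k sq by (intro bexI[of _ k] mult_strict_right_mono) auto
  qed simp
  also have "(\<Sum>i\<in>UNIV. ?r\<^sup>2 * (u i \<bullet> v)\<^sup>2) = ?r\<^sup>2"
    by (simp add: one flip: sum_distrib_left)
  finally show False by simp
qed

text \<open>
  Distinct entries in the list of eigenvalues mean one-dimensional eigenspaces, in particular
  nonzero ones; eigenvectors of a symmetric matrix to different eigenvalues are orthogonal.
\<close>

lemma eigenframe_exists:
  fixes A :: "real ^ 'n ^ 'n"
  assumes sym: "transpose A = A" and ev: "lists_eigenvalues l A" and inj: "inj l"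
  shows "\<exists>u. eigenframe A l u"
proof -
  have "\<exists>u. norm u = 1 \<and> A *v u = l i *\<^sub>R u" for i
  proof -
    have "{j. l j = l i} = {i}" using inj by (auto dest: injD)
    then have "dim (eigenspace A (l i)) = 1"
      using ev unfolding lists_eigenvalues_def by (metis card.empty card_insert_disjoint empty_iff finite.emptyI One_nat_def)
    then have "\<not> eigenspace A (l i) \<subseteq> {0}"
      using dim_eq_0[of "eigenspace A (l i)"] by simp
    then obtain w where w: "w \<noteq> 0" "A *v w = l i *\<^sub>R w"
      by (auto simp: eigenspace_def)
    then show ?thesis
      by (intro exI[of _ "w /\<^sub>R norm w"]) (simp add: linear_cmul)
  qed
  then obtain u where u: "\<And>i. norm (u i) = 1" "\<And>i. A *v u i = l i *\<^sub>R u i" by metis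
  have "u i \<bullet> u j = 0" if "i \<noteq> j" for i j
  proof -
    have "(A *v u i) \<bullet> u j = u i \<bullet> (A *v u j)"
      by (metis dot_lmul_matrix sym transpose_matrix_vector)
    then have "(l i - l j) * (u i \<bullet> u j) = 0" by (simp add: u algebra_simps)
    then show ?thesis using that inj by (auto dest: injD)
  qed
  then have "eigenframe A l u"
    using u by (simp add: eigenframe_def norm_eq_1)
  then show ?thesis by blast
qed

text \<open>
  Moving \<open>B\<close> to the other side of the inner product turns both terms on the right into multiples of
  the overlap \<open>w j \<bullet> u i\<close>.  If the eigenvalues involved stay apart, the overlap is thus of the order
  of \<open>A - B\<close>; this drives both the continuity and the differentiability of eigenvectors.
\<close>

lemma eigenframe_overlap:
  assumes "eigenframe A l u" "eigenframe B m w"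
  shows "(l i - m j) * (w j \<bullet> u i) = w j \<bullet> ((A - B) *v u i)"
proof -
  have "w j \<bullet> ((A - B) *v u i) = w j \<bullet> (l i *\<^sub>R u i) - m j * (w j \<bullet> u i)"
    using eigenframe_inner_apply[OF assms(2), of j "u i"]
    by (simp add: matrix_vector_mult_diff_rdistrib inner_diff_right eigenframe_eigen[OF assms(1)])
  then show ?thesis by (simp add: left_diff_distrib)
qed

section \<open>Sorting the eigenvalues\<close>

text \<open>
  The segments \<open>{..i}\<close> and \<open>{i..}\<close> are mapped injectively into \<open>{..p i}\<close> and \<open>{p i..}\<close>; counting
  rules out \<open>p i < i\<close> in the first case and \<open>p i > i\<close> in the second.
\<close>

lemma strict_mono_finite_id:
  fixes p :: "'n::{finite,linorder} \<Rightarrow> 'n"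
  assumes "strict_mono p"
  shows "p i = i"
proof (rule antisym)
  have inj: "inj p" using assms by (rule strict_mono_imp_inj_on)
  have "card {..i} = card (p ` {..i})"
    by (simp add: card_image inj_on_subset[OF inj])
  also have "\<dots> \<le> card {..p i}"
    using assms by (intro card_mono) (auto simp: strict_mono_less_eq)
  finally have le: "card {..i} \<le> card {..p i}" .
  show "i \<le> p i"
  proof (rule ccontr)
    assume "\<not> i \<le> p i"
    then have "{..p i} \<subset> {..i}" by auto
    then show False using le psubset_card_mono[of "{..i}" "{..p i}"] by simp
  qed
  have "card {i..} = card (p ` {i..})"
    by (simp add: card_image inj_on_subset[OF inj])
  also have "\<dots> \<le> card {p i..}"
    using assms by (intro card_mono) (auto simp: strict_mono_less_eq)
  finally have ge: "card {i..} \<le> card {p i..}" .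
  show "p i \<le> i"
  proof (rule ccontr)
    assume "\<not> p i \<le> i"
    then have "{p i..} \<subset> {i..}" by auto
    then show False using ge psubset_card_mono[of "{i..}" "{p i..}"] by simp
  qed
qed

text \<open>
  The position of an index \<open>i\<close> in the order of its type is \<open>card {..<i}\<close>; \<open>i\<close> receives the value at
  this position in the sorted list of all values.
\<close>

lemma inj_real_sortable:
  fixes f :: "'n::{finite,linorder} \<Rightarrow> real"
  assumes "inj f"
  shows "\<exists>p :: 'n \<Rightarrow> 'n. bij p \<and> strict_mono (f \<circ> p)"
proof -
  define ys where "ys = sorted_list_of_set (range f)"
  define g where "g i = ys ! card {..<i}" for i :: 'n
  have len: "length ys = CARD('n)"
    using assms by (simp add: ys_def card_image)
  have lt: "card {..<i} < length ys" for i :: 'n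
    unfolding len by (rule psubset_card_mono) auto
  have mono: "strict_mono g"
  proof (rule strict_monoI)
    fix i j :: 'n assume "i < j"
    then have "card {..<i} < card {..<j}"
      by (intro psubset_card_mono) auto
    then show "g i < g j"
      unfolding g_def ys_def
      by (intro sorted_wrt_nth_less[OF strict_sorted_list_of_set]) (use lt in \<open>auto simp: ys_def\<close>)
  qed
  have "g i \<in> range f" for i
    using nth_mem[OF lt[of i]] by (simp add: g_def ys_def)
  then have "\<forall>i. \<exists>k. g i = f k" by auto
  then obtain p where p: "\<And>i. g i = f (p i)" by (auto dest: choice)
  have "inj p"
    using strict_mono_imp_inj_on[OF mono, of UNIV] by (simp add: inj_on_def p)
  then have "bij p" by (simp add: bij_def finite_UNIV_inj_surj)
  moreover have "f \<circ> p = g" by (auto simp: p)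
  ultimately show ?thesis using mono by (intro exI[of _ p]) simp
qed

lemma lists_eigenvalues_permute:
  assumes "lists_eigenvalues l A" "bij p"
  shows "lists_eigenvalues (l \<circ> p) A"
proof -
  have "card {i. (l \<circ> p) i = t} = card {i. l i = t}" for t
    using card_vimage_inj[of p "{i. l i = t}"] assms(2)
    by (simp add: bij_def vimage_def)
  then show ?thesis using assms(1) by (simp add: lists_eigenvalues_def)
qed

section \<open>Continuity of the sorted eigenvalues and of the eigenlines\<close>

lemma bounded_bilinear_matrix_vector_mult:
  "bounded_bilinear ((*v) :: real ^ 'n ^ 'm \<Rightarrow> real ^ 'n \<Rightarrow> real ^ 'm)"
  unfolding bilinear_conv_bounded_bilinear[symmetric] bilinear_def
  by (intro conjI allI linearI)
    (simp_all add: matrix_vector_mult_add_rdistrib matrix_vector_right_distrib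
      matrix_vector_mult_scaleR scaleR_matrix_vector_assoc[symmetric])

lemma tendsto_matrix_diff_apply:
  fixes A :: "'a::t2_space \<Rightarrow> real ^ 'n ^ 'm"
  assumes A: "isCont A x0" and unit: "\<And>x. norm (v x) = 1"
  shows "((\<lambda>x. (A x - A x0) *v v x) \<longlongrightarrow> 0) (at x0)"
proof -
  obtain K where K: "\<And>(M :: real ^ 'n ^ 'm) w. norm (M *v w) \<le> norm M * norm w * K"
    using bounded_bilinear.bounded[OF bounded_bilinear_matrix_vector_mult] by blast
  have "((\<lambda>x. norm (A x - A x0) * K) \<longlongrightarrow> 0) (at x0)"
    using A unfolding isCont_def by (intro tendsto_mult_left_zero tendsto_norm_zero LIM_zero)
  moreover have "norm ((A x - A x0) *v v x) \<le> norm (A x - A x0) * K" for x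
    using K[of "A x - A x0" "v x"] unit[of x] by simp
  ultimately show ?thesis
    by (simp add: Lim_null_comparison[of _ "\<lambda>x. norm (A x - A x0) * K"])
qed

text \<open>
  The eigenvalues are sorted at each point, but the eigenvectors are chosen pointwise, without any
  regularity: their signs may jump.
\<close>

locale eigenframe_family =
  fixes A :: "'a::t2_space \<Rightarrow> real ^ 'n::{finite,linorder} ^ 'n::{finite,linorder}"
    and l :: "'n::{finite,linorder} \<Rightarrow> 'a \<Rightarrow> real"
    and u :: "'n::{finite,linorder} \<Rightarrow> 'a \<Rightarrow> real ^ 'n::{finite,linorder}"
  assumes frame: "\<And>x. eigenframe (A x) (\<lambda>i. l i x) (\<lambda>i. u i x)"
    and increasing: "\<And>x. strict_mono (\<lambda>i. l i x)"
begin

lemma simple: "i \<noteq> j \<Longrightarrow> l i x \<noteq> l j x"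
  using strict_mono_eq[OF increasing] by blast

text \<open>
  The vector \<open>u j x0\<close> is an approximate eigenvector of \<open>A x\<close> to the value \<open>l j x0\<close>, so some eigenvalue
  \<open>l (p j) x\<close> is close to \<open>l j x0\<close>.  Once the errors are smaller than the gaps at \<open>x0\<close>, the map \<open>p\<close>
  preserves the strict order, so it is the identity.
\<close>

lemma isCont_eigenvalue:
  assumes A: "isCont A x0"
  shows "isCont (l i) x0"
proof -
  define r where "r j x = norm ((A x - A x0) *v u j x0)" for j x
  have r0: "(r j \<longlongrightarrow> 0) (at x0)" for j
    unfolding r_def
    by (intro tendsto_norm_zero tendsto_matrix_diff_apply A eigenframe_norm[OF frame])
  have "\<forall>\<^sub>F x in at x0. j < k \<longrightarrow> r j x + r k x < l k x0 - l j x0" for j k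
  proof (cases "j < k")
    case True
    then have "0 < l k x0 - l j x0" using strict_monoD[OF increasing] by simp
    moreover have "((\<lambda>x. r j x + r k x) \<longlongrightarrow> 0) (at x0)"
      using tendsto_add[OF r0 r0] by simp
    ultimately show ?thesis
      using order_tendstoD(2) by (fastforce elim: eventually_mono)
  qed simp
  then have "\<forall>\<^sub>F x in at x0. \<forall>j k. j < k \<longrightarrow> r j x + r k x < l k x0 - l j x0"
    by (intro eventually_all_finite)
  then have "\<forall>\<^sub>F x in at x0. norm (l i x - l i x0) \<le> r i x"
  proof eventually_elim
    case (elim x)
    have "\<exists>k. \<bar>l k x - l j x0\<bar> \<le> r j x" for j
      using eigenframe_residual[OF frame eigenframe_norm[OF frame], of x "l j x0" j x0]
      by (simp add: r_def matrix_vector_mult_diff_rdistrib eigenframe_eigen[OF frame])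
    then obtain p where p: "\<And>j. \<bar>l (p j) x - l j x0\<bar> \<le> r j x" by metis
    have "strict_mono p"
    proof (rule strict_monoI)
      fix j k :: 'n assume "j < k"
      then have "l (p j) x < l (p k) x" using elim p[of j] p[of k] by fastforce
      then show "p j < p k" using strict_mono_less[OF increasing] by blast
    qed
    then show ?case using p[of i] by (simp add: strict_mono_finite_id)
  qed
  then have "((\<lambda>x. l i x - l i x0) \<longlongrightarrow> 0) (at x0)"
    by (rule Lim_null_comparison[OF _ r0])
  then show ?thesis unfolding isCont_def by (rule LIM_zero_cancel)
qed

text \<open>
  The projection onto the line of \<open>u i x\<close> does not see the sign of \<open>u i x\<close>.  In the eigenbasis at \<open>x0\<close>
  its entries are products of overlaps \<open>\<alpha> k x * \<alpha> j x\<close>; all overlaps but \<open>\<alpha> i\<close> tend to zero, and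
  then \<open>(\<alpha> i)\<^sup>2\<close> tends to one by Parseval's identity.
\<close>

lemma isCont_eigenprojection:
  assumes A: "isCont A x0"
  shows "isCont (\<lambda>x. (u i x \<bullet> a) *\<^sub>R u i x) x0"
proof -
  define \<alpha> where "\<alpha> j x = u j x0 \<bullet> u i x" for j x
  have off: "(\<alpha> j \<longlongrightarrow> 0) (at x0)" if "j \<noteq> i" for j
  proof -
    have lim: "((\<lambda>x. l i x - l j x0) \<longlongrightarrow> l i x0 - l j x0) (at x0)"
      using isCont_eigenvalue[OF A, of i] unfolding isCont_def by (intro tendsto_intros)
    have ne: "l i x0 - l j x0 \<noteq> 0" using simple that by simp
    have "((\<lambda>x. (u j x0 \<bullet> ((A x - A x0) *v u i x)) / (l i x - l j x0))
        \<longlongrightarrow> (u j x0 \<bullet> 0) / (l i x0 - l j x0)) (at x0)"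
      by (intro tendsto_divide tendsto_inner tendsto_const lim ne
          tendsto_matrix_diff_apply A eigenframe_norm[OF frame])
    moreover have "\<forall>\<^sub>F x in at x0. (u j x0 \<bullet> ((A x - A x0) *v u i x)) / (l i x - l j x0) = \<alpha> j x"
      using tendsto_imp_eventually_ne[OF lim ne]
    proof eventually_elim
      case (elim x)
      then show ?case
        using eigenframe_overlap[OF frame frame, of i x j x0] by (simp add: \<alpha>_def field_simps)
    qed
    ultimately show ?thesis by (simp add: Lim_transform_eventually)
  qed
  have sq: "((\<lambda>x. (\<alpha> i x)\<^sup>2) \<longlongrightarrow> 1) (at x0)"
  proof -
    have "((\<lambda>x. 1 - (\<Sum>j\<in>UNIV - {i}. (\<alpha> j x)\<^sup>2)) \<longlongrightarrow> 1 - (\<Sum>j\<in>UNIV - {i}. 0\<^sup>2)) (at x0)"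
      by (intro tendsto_intros off) auto
    moreover have "(\<alpha> i x)\<^sup>2 = 1 - (\<Sum>j\<in>UNIV - {i}. (\<alpha> j x)\<^sup>2)" for x
      using eigenframe_parseval[OF frame, of "u i x" x0] eigenframe_norm[OF frame, of i x]
      by (simp add: \<alpha>_def sum.remove[of UNIV i])
    ultimately show ?thesis by simp
  qed
  have bounded: "norm (\<alpha> j x) \<le> 1" for j x
    using Cauchy_Schwarz_ineq2[of "u j x0" "u i x"] by (simp add: \<alpha>_def eigenframe_norm[OF frame])
  have prod: "((\<lambda>x. \<alpha> k x * \<alpha> j x) \<longlongrightarrow> (if k = i \<and> j = i then 1 else 0)) (at x0)" for j k
  proof -
    consider "j = i" "k = i" | "j \<noteq> i" | "k \<noteq> i" by blast
    then show ?thesis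
    proof cases
      case 1 then show ?thesis using sq by (simp add: power2_eq_square)
    next
      case 2
      have "((\<lambda>x. \<alpha> k x * \<alpha> j x) \<longlongrightarrow> 0) (at x0)"
        by (rule Lim_null_comparison[OF _ tendsto_norm_zero[OF off[OF 2]]])
          (use bounded[of k] in \<open>auto simp: abs_mult intro!: always_eventually mult_left_le_one_le\<close>)
      then show ?thesis using 2 by simp
    next
      case 3
      have "((\<lambda>x. \<alpha> k x * \<alpha> j x) \<longlongrightarrow> 0) (at x0)"
        by (rule Lim_null_comparison[OF _ tendsto_norm_zero[OF off[OF 3]]])
          (use bounded[of j] in \<open>auto simp: abs_mult intro!: always_eventually mult_right_le_one_le\<close>)
      then show ?thesis using 3 by simp
    qed
  qed
  have expand: "(u i x \<bullet> a) *\<^sub>R u i x =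
      (\<Sum>j\<in>UNIV. \<Sum>k\<in>UNIV. ((\<alpha> k x * \<alpha> j x) * (u k x0 \<bullet> a)) *\<^sub>R u j x0)" for x
  proof -
    have ux: "u i x = (\<Sum>j\<in>UNIV. \<alpha> j x *\<^sub>R u j x0)"
      unfolding \<alpha>_def by (rule eigenframe_expand[OF frame])
    have "u i x \<bullet> a = (\<Sum>k\<in>UNIV. \<alpha> k x * (u k x0 \<bullet> a))"
      by (subst ux) (simp add: inner_sum_left)
    then have "(u i x \<bullet> a) *\<^sub>R u i x = (\<Sum>k\<in>UNIV. \<alpha> k x * (u k x0 \<bullet> a)) *\<^sub>R (\<Sum>j\<in>UNIV. \<alpha> j x *\<^sub>R u j x0)"
      using ux by simp
    then show ?thesis
      by (simp add: scaleR_sum_right scaleR_sum_left sum_distrib_left mult_ac)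
  qed
  have "((\<lambda>x. (u i x \<bullet> a) *\<^sub>R u i x) \<longlongrightarrow>
      (\<Sum>j\<in>UNIV. \<Sum>k\<in>UNIV. ((if k = i \<and> j = i then 1 else 0) * (u k x0 \<bullet> a)) *\<^sub>R u j x0)) (at x0)"
    unfolding expand by (intro tendsto_intros prod)
  also have "(\<Sum>j\<in>UNIV. \<Sum>k\<in>UNIV. ((if k = i \<and> j = i then 1 else 0) * (u k x0 \<bullet> a)) *\<^sub>R u j x0)
      = (\<Sum>j\<in>UNIV. if j = i then (u i x0 \<bullet> a) *\<^sub>R u j x0 else 0)"
    by (rule sum.cong) (auto simp: if_distrib[of "\<lambda>t. t * _"] if_distrib[of "\<lambda>t. t *\<^sub>R _"] cong: if_cong)
  finally show ?thesis by (simp add: isCont_def)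
qed

end

section \<open>Orienting a continuous line field\<close>

text \<open>
  The continuity of the line field spanned by \<open>u\<close> is expressed through its orthogonal projections.
  The set \<open>C\<close> of its unit vectors is a two-sheeted covering of \<open>S\<close>: near a point \<open>y\<close>, the sign of the
  inner product with \<open>u y\<close> separates the sheets, and the normalised projections of \<open>u y\<close> form a
  continuous section.  The identity of the simply connected set \<open>S\<close> lifts to \<open>C\<close>.
\<close>

lemma unit_line_field_lift:
  fixes u :: "'a::real_normed_vector \<Rightarrow> 'b::real_inner"
  assumes S: "simply_connected S" "locally path_connected S"
    and unit: "\<And>x. x \<in> S \<Longrightarrow> norm (u x) = 1"
    and proj: "\<And>a. continuous_on S (\<lambda>x. (u x \<bullet> a) *\<^sub>R u x)"
  obtains v where "continuous_on S v" "\<And>x. x \<in> S \<Longrightarrow> v x = u x \<or> v x = - u x"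
proof -
  define C where "C = {(x, w). x \<in> S \<and> (w = u x \<or> w = - u x)}"
  have "covering_space C fst S"
  proof
    show "continuous_on C fst" by (intro continuous_intros)
    show "fst ` C = S" by (force simp: C_def image_iff)
  next
    fix y assume "y \<in> S"
    define a where "a = u y"
    define T where "T = {x \<in> S. u x \<bullet> a \<noteq> 0}"
    define s where "s x = sgn ((u x \<bullet> a) *\<^sub>R u x)" for x
    define V where "V t = {z \<in> C. t * (snd z \<bullet> a) > 0}" for t :: real
    have nz: "u x \<noteq> 0" if "x \<in> S" for x using unit[OF that] by auto
    have "T = S \<inter> (\<lambda>x. (u x \<bullet> a) *\<^sub>R u x) -` (- {0})"
      using nz by (auto simp: T_def)
    then have T: "openin (top_of_set S) T"
      using continuous_openin_preimage_gen[OF proj, of "- {0}" a] by (simp add: open_Compl)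
    have s_eq: "s x = sgn (u x \<bullet> a) *\<^sub>R u x" if "x \<in> S" for x
      using unit[OF that] by (simp add: s_def sgn_scaleR sgn_div_norm)
    have "continuous_on T (\<lambda>x. (u x \<bullet> a) *\<^sub>R u x)"
      by (rule continuous_on_subset[OF proj]) (auto simp: T_def)
    then have s_cont: "continuous_on T s"
      unfolding s_def by (rule continuous_on_sgn) (use nz in \<open>auto simp: T_def\<close>)
    have sheet: "homeomorphism (V t) T fst (\<lambda>x. (x, t *\<^sub>R s x))" if t: "t = 1 \<or> t = - 1" for t
    proof (rule homeomorphismI)
      show "continuous_on T (\<lambda>x. (x, t *\<^sub>R s x))" by (intro continuous_intros s_cont)
      show "continuous_on (V t) fst" by (intro continuous_intros)
      show "fst ` V t \<subseteq> T"
        using t by (auto simp: V_def C_def T_def)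
      show "(\<lambda>x. (x, t *\<^sub>R s x)) ` T \<subseteq> V t"
        using t by (auto simp: V_def C_def T_def s_eq sgn_if)
      show "(fst z, t *\<^sub>R s (fst z)) = z" if "z \<in> V t" for z
        using that t by (auto simp: V_def C_def s_eq sgn_if)
    qed auto
    have "\<Union>{V 1, V (- 1)} = C \<inter> fst -` T"
      by (auto simp: V_def C_def T_def)
    moreover have "openin (top_of_set C) (V t)" for t
    proof -
      have "V t = C \<inter> (\<lambda>z. t * (snd z \<bullet> a)) -` {0<..}" by (auto simp: V_def)
      moreover have "continuous_on C (\<lambda>z. t * (snd z \<bullet> a))" by (intro continuous_intros)
      ultimately show ?thesis by (simp add: continuous_openin_preimage_gen)
    qed
    moreover have "pairwise disjnt {V 1, V (- 1)}"
      by (auto simp: pairwise_def disjnt_def V_def)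
    moreover have "\<exists>q. homeomorphism (V 1) T fst q" "\<exists>q. homeomorphism (V (- 1)) T fst q"
      using sheet by blast+
    moreover have "y \<in> T"
      using \<open>y \<in> S\<close> nz by (simp add: T_def a_def)
    ultimately show "\<exists>T. y \<in> T \<and> openin (top_of_set S) T \<and>
        (\<exists>v. \<Union>v = C \<inter> fst -` T \<and> (\<forall>u\<in>v. openin (top_of_set C) u) \<and>
             pairwise disjnt v \<and> (\<forall>u\<in>v. \<exists>q. homeomorphism u T fst q))"
      using T by (intro exI[of _ T] conjI exI[of _ "{V 1, V (- 1)}"]) auto
  qed
  then obtain g where g: "continuous_on S g" "g \<in> S \<rightarrow> C" "\<And>x. x \<in> S \<Longrightarrow> fst (g x) = x"
    using covering_space_lift[of C fst S S "\<lambda>x. x"] S by auto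
  show ?thesis
  proof
    show "continuous_on S (\<lambda>x. snd (g x))" by (intro continuous_intros g)
    show "snd (g x) = u x \<or> snd (g x) = - u x" if "x \<in> S" for x
    proof -
      have "g x \<in> C" using g(2) that by blast
      then show ?thesis using g(3)[OF that] by (cases "g x") (auto simp: C_def)
    qed
  qed
qed

section \<open>Differentiability of continuous eigenvectors\<close>

text \<open>
  On a finite-dimensional domain, continuity of the derivative in the operator norm can be tested
  on one direction at a time.
\<close>

lemma C1I:
  fixes f :: "'a::euclidean_space \<Rightarrow> 'b::real_normed_vector"
  assumes D: "\<And>x. (f has_derivative D x) (at x)"
    and cont: "\<And>h. continuous_on UNIV (\<lambda>x. D x h)"
  shows "C1 f"
proof -
  have app: "blinfun_apply (Blinfun (D x)) = D x" for x
    using D by (intro bounded_linear_Blinfun_apply) (rule has_derivative_bounded_linear)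
  have "continuous_on UNIV (\<lambda>x. Blinfun (D x))"
    by (rule continuous_on_blinfun_componentwise) (simp add: app cont)
  then show ?thesis
    unfolding C1_def using D app by (intro exI[of _ "\<lambda>x. Blinfun (D x)"]) simp
qed

text \<open>
  In the product rule, the derivative of \<open>g\<close> is multiplied by \<open>f x0 = 0\<close>.  Continuity of \<open>g\<close> is enough
  for this term to disappear: \<open>pr (f x) (g x - g x0)\<close> is \<open>O(\<bar>x - x0\<bar>)\<close> times a null function.
\<close>

lemma has_derivative_bilinear_at_zero:
  fixes pr :: "'a::real_normed_vector \<Rightarrow> 'b::real_normed_vector \<Rightarrow> 'c::real_normed_vector"
    and f :: "'d::real_normed_vector \<Rightarrow> 'a"
  assumes bil: "bounded_bilinear pr" and f: "(f has_derivative f') (at x0)"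
    and zero: "f x0 = 0" and g: "isCont g x0"
  shows "((\<lambda>x. pr (f x) (g x)) has_derivative (\<lambda>h. pr (f' h) (g x0))) (at x0)"
proof -
  interpret bounded_bilinear "pr" by (rule bil)
  obtain K where K: "\<And>a b. norm (pr a b) \<le> norm a * norm b * K" and "K \<ge> 0"
    using nonneg_bounded by blast
  obtain B where B: "\<And>h. norm (f' h) \<le> norm h * B"
    using bounded_linear.bounded[OF has_derivative_bounded_linear[OF f]] by blast
  define q where "q y = norm (f y - f x0 - f' (y - x0)) / norm (y - x0)" for y
  have q: "(q \<longlongrightarrow> 0) (at x0)"
    using f unfolding has_derivative_iff_norm q_def by blast
  have gg: "((\<lambda>y. g y - g x0) \<longlongrightarrow> 0) (at x0)"
    using g by (simp add: isCont_def LIM_zero)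
  have bound: "norm (pr (f y) (g y - g x0)) / norm (y - x0) \<le> (q y + B) * norm (g y - g x0) * K"
    if "y \<noteq> x0" for y
  proof -
    have "norm (f y) \<le> norm (f y - f' (y - x0)) + norm (f' (y - x0))"
      using norm_triangle_ineq[of "f y - f' (y - x0)" "f' (y - x0)"] by simp
    also have "\<dots> \<le> (q y + B) * norm (y - x0)"
      using B[of "y - x0"] that by (simp add: q_def zero field_simps)
    finally have "norm (f y) * (norm (g y - g x0) * K) \<le> (q y + B) * norm (y - x0) * (norm (g y - g x0) * K)"
      using \<open>K \<ge> 0\<close> by (intro mult_right_mono) auto
    then show ?thesis
      using K[of "f y" "g y - g x0"] that by (simp add: field_simps)
  qed
  have "((\<lambda>y. (q y + B) * norm (g y - g x0) * K) \<longlongrightarrow> (0 + B) * norm (0::'b) * K) (at x0)"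
    by (intro tendsto_intros q gg)
  then have lim: "((\<lambda>y. (q y + B) * norm (g y - g x0) * K) \<longlongrightarrow> 0) (at x0)" by simp
  have "((\<lambda>y. norm (pr (f y) (g y - g x0)) / norm (y - x0)) \<longlongrightarrow> 0) (at x0)"
    by (rule Lim_null_comparison[OF _ lim]) (use bound in \<open>auto simp: eventually_at_filter\<close>)
  then have "((\<lambda>y. pr (f y) (g y - g x0)) has_derivative (\<lambda>h. 0)) (at x0)"
    by (simp add: has_derivative_iff_norm zero_right)
  moreover have "((\<lambda>y. pr (f y) (g x0)) has_derivative (\<lambda>h. pr (f' h) (g x0))) (at x0)"
    by (rule bounded_linear.has_derivative[OF bounded_linear_left f])
  ultimately have "((\<lambda>y. pr (f y) (g x0) + pr (f y) (g y - g x0)) has_derivative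
      (\<lambda>h. pr (f' h) (g x0) + 0)) (at x0)"
    by (rule has_derivative_add[rotated])
  then show ?thesis by (simp add: diff_right)
qed

text \<open>
  The coordinates \<open>\<alpha> j x\<close> of \<open>u i x\<close> in the eigenbasis at \<open>x0\<close> are differentiated one by one.  For
  \<open>j \<noteq> i\<close> the overlap identity writes \<open>\<alpha> j\<close> as a quotient of \<open>A x - A x0\<close>, which vanishes at \<open>x0\<close>, so
  the eigenvalues and eigenvectors in it contribute only their values at \<open>x0\<close>.  The remaining coordinate is near
  one, hence \<open>\<alpha> i = sqrt (1 - \<Sum>\<^sub>j\<^sub>\<noteq>\<^sub>i (\<alpha> j)\<^sup>2)\<close>, with derivative zero.
\<close>

lemma eigenvector_has_derivative:
  fixes A :: "'a::real_normed_vector \<Rightarrow> real ^ 'n::finite ^ 'n"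
  assumes frame: "\<And>x. eigenframe (A x) (\<lambda>i. l i x) (\<lambda>i. u i x)"
    and simple: "\<And>j. j \<noteq> i \<Longrightarrow> l j x0 \<noteq> l i x0"
    and A: "(A has_derivative A') (at x0)"
    and l: "isCont (l i) x0" and u: "isCont (u i) x0"
  shows "(u i has_derivative
      (\<lambda>h. \<Sum>j\<in>UNIV - {i}. ((u j x0 \<bullet> (A' h *v u i x0)) / (l i x0 - l j x0)) *\<^sub>R u j x0)) (at x0)"
proof -
  define \<alpha> where "\<alpha> j x = u j x0 \<bullet> u i x" for j x
  have ii: "\<alpha> i x0 = 1" and ij: "j \<noteq> i \<Longrightarrow> \<alpha> j x0 = 0" for j
    by (simp_all add: \<alpha>_def eigenframe_inner_frame[OF frame])
  have off: "(\<alpha> j has_derivative (\<lambda>h. (u j x0 \<bullet> (A' h *v u i x0)) / (l i x0 - l j x0))) (at x0)"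
    if "j \<noteq> i" for j
  proof -
    have ne: "l i x0 - l j x0 \<noteq> 0" using simple[OF that] by simp
    have "((\<lambda>x. A x - A x0) has_derivative A') (at x0)"
      using has_derivative_diff[OF A has_derivative_const] by simp
    \<comment> \<open>The scalar denominator, which is only continuous, is put into the continuous factor.\<close>
    then have "((\<lambda>x. (A x - A x0) *v ((1 / (l i x - l j x0)) *\<^sub>R u i x)) has_derivative
        (\<lambda>h. A' h *v ((1 / (l i x0 - l j x0)) *\<^sub>R u i x0))) (at x0)"
      by (rule has_derivative_bilinear_at_zero[OF bounded_bilinear_matrix_vector_mult])
        (use ne in \<open>auto intro!: continuous_intros l u\<close>)
    then have "((\<lambda>x. u j x0 \<bullet> ((A x - A x0) *v ((1 / (l i x - l j x0)) *\<^sub>R u i x))) has_derivative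
        (\<lambda>h. u j x0 \<bullet> (A' h *v ((1 / (l i x0 - l j x0)) *\<^sub>R u i x0)))) (at x0)"
      by (rule has_derivative_inner_right)
    then have "((\<lambda>x. (u j x0 \<bullet> ((A x - A x0) *v u i x)) / (l i x - l j x0)) has_derivative
        (\<lambda>h. (u j x0 \<bullet> (A' h *v u i x0)) / (l i x0 - l j x0))) (at x0)"
      by (simp add: matrix_vector_mult_scaleR)
    moreover have "\<forall>\<^sub>F x in at x0. (u j x0 \<bullet> ((A x - A x0) *v u i x)) / (l i x - l j x0) = \<alpha> j x"
    proof -
      have "((\<lambda>x. l i x - l j x0) \<longlongrightarrow> l i x0 - l j x0) (at x0)"
        using l unfolding isCont_def by (intro tendsto_intros)
      from tendsto_imp_eventually_ne[OF this ne] show ?thesis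
      proof eventually_elim
        case (elim x)
        then show ?case
          using eigenframe_overlap[OF frame frame, of i x j x0] by (simp add: \<alpha>_def field_simps)
      qed
    qed
    ultimately show ?thesis
      by (rule has_derivative_transform_eventually) (simp_all add: ij[OF that])
  qed
  have diag: "(\<alpha> i has_derivative (\<lambda>h. 0)) (at x0)"
  proof -
    define q where "q x = (\<Sum>j\<in>UNIV - {i}. (\<alpha> j x)\<^sup>2)" for x
    have q0: "q x0 = 0" using ij by (simp add: q_def)
    have "(q has_derivative (\<lambda>h. \<Sum>j\<in>UNIV - {i}.
        of_nat 2 * ((u j x0 \<bullet> (A' h *v u i x0)) / (l i x0 - l j x0)) * \<alpha> j x0 ^ (2 - 1))) (at x0)"
      unfolding q_def by (intro has_derivative_sum has_derivative_power off) auto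
    then have q: "(q has_derivative (\<lambda>h. 0)) (at x0)" by (simp add: ij)
    have "((\<lambda>x. 1 - q x) has_derivative (\<lambda>h. 0)) (at x0)"
      using has_derivative_diff[OF has_derivative_const q] by simp
    from has_derivative_real_sqrt[OF _ this]
    have "((\<lambda>x. sqrt (1 - q x)) has_derivative (\<lambda>h. 0)) (at x0)"
      by (simp add: q0)
    moreover have "\<forall>\<^sub>F x in at x0. sqrt (1 - q x) = \<alpha> i x"
    proof -
      have "(\<alpha> i \<longlongrightarrow> \<alpha> i x0) (at x0)"
        using u unfolding \<alpha>_def isCont_def by (intro tendsto_intros)
      then have "\<forall>\<^sub>F x in at x0. 0 < \<alpha> i x"
        by (rule order_tendstoD) (simp add: ii)
      then show ?thesis
      proof eventually_elim
        case (elim x)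
        have "1 - q x = (\<alpha> i x)\<^sup>2"
          using eigenframe_parseval[OF frame, of "u i x" x0] eigenframe_norm[OF frame, of i x]
          by (simp add: \<alpha>_def q_def sum.remove[of UNIV i])
        then show ?case using elim by simp
      qed
    qed
    ultimately show ?thesis
      by (rule has_derivative_transform_eventually) (simp_all add: ii q0)
  qed
  have "((\<lambda>x. \<alpha> i x *\<^sub>R u i x0 + (\<Sum>j\<in>UNIV - {i}. \<alpha> j x *\<^sub>R u j x0)) has_derivative
      (\<lambda>h. 0 *\<^sub>R u i x0 + (\<Sum>j\<in>UNIV - {i}. ((u j x0 \<bullet> (A' h *v u i x0)) / (l i x0 - l j x0)) *\<^sub>R u j x0))) (at x0)"
    by (intro has_derivative_add has_derivative_sum has_derivative_scaleR_left diag off) auto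
  moreover have "\<alpha> i x *\<^sub>R u i x0 + (\<Sum>j\<in>UNIV - {i}. \<alpha> j x *\<^sub>R u j x0) = u i x" for x
    using eigenframe_expand[OF frame, of "u i x" x0] by (simp add: \<alpha>_def sum.remove[of UNIV i])
  ultimately show ?thesis by simp
qed

lemma C1_vec_lambda:
  fixes f :: "'i::finite \<Rightarrow> 'a::euclidean_space \<Rightarrow> 'b::euclidean_space"
  assumes "\<And>i. C1 (f i)"
  shows "C1 (\<lambda>x. \<chi> i. f i x)"
proof -
  obtain f' where f': "\<And>i x. (f i has_derivative blinfun_apply (f' i x)) (at x)"
    and cont: "\<And>i. continuous_on UNIV (f' i)"
    using assms unfolding C1_def by metis
  show ?thesis
  proof (rule C1I)
    show "((\<lambda>x. \<chi> i. f i x) has_derivative (\<lambda>h. \<chi> i. f' i x h)) (at x)" for x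
      by (subst has_derivative_componentwise_within)
        (auto simp: Basis_vec_def inner_axis intro!: has_derivative_inner_left f')
    show "continuous_on UNIV (\<lambda>x. \<chi> i. f' i x h)" for h
      by (intro continuous_intros cont)
  qed
qed

lemma C1_bounded_linear:
  fixes f :: "'a::euclidean_space \<Rightarrow> 'b::real_normed_vector"
  assumes T: "bounded_linear T" and f: "C1 f"
  shows "C1 (\<lambda>x. T (f x))"
proof -
  obtain f' where f': "\<And>x. (f has_derivative blinfun_apply (f' x)) (at x)" "continuous_on UNIV f'"
    using f unfolding C1_def by blast
  show ?thesis
    by (rule C1I[OF bounded_linear.has_derivative[OF T f'(1)]])
      (intro bounded_linear.continuous_on[OF T] continuous_intros f'(2))
qed

section \<open>Global frames of eigenvectors\<close>

text \<open>
  Sorting yields \<open>l\<close>; arbitrary pointwise unit eigenvectors \<open>w\<close> span continuous lines, whose global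
  orientations \<open>u\<close> are again eigenvectors.  The permutations \<open>p\<close> record that \<open>l\<close> only reorders \<open>e\<close>,
  so that bounds on the gaps between the eigenvalues carry over.
\<close>

theorem C1_orthonormal_eigenframe:
  fixes A :: "'a::euclidean_space \<Rightarrow> real ^ 'n::{finite,linorder} ^ 'n::{finite,linorder}"
  assumes A: "C1 A" and sym: "\<And>x. transpose (A x) = A x"
    and ev: "\<And>x. lists_eigenvalues (\<lambda>i. e i x) (A x)"
    and inj: "\<And>x. inj (\<lambda>i. e i x)"
  shows "\<exists>l u (p :: 'a \<Rightarrow> 'n \<Rightarrow> 'n). (\<forall>x. eigenframe (A x) (\<lambda>i. l i x) (\<lambda>i. u i x)) \<and>
    (\<forall>x. inj (p x) \<and> (\<forall>i. l i x = e (p x i) x)) \<and>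
    (\<forall>i. continuous_on UNIV (l i)) \<and> (\<forall>i. C1 (u i))"
proof -
  obtain A' where A': "\<And>x. (A has_derivative blinfun_apply (A' x)) (at x)"
    and A'_cont: "continuous_on UNIV A'"
    using A unfolding C1_def by blast
  have A_cont: "isCont A x" for x
    using has_derivative_continuous[OF A'] .
  have "\<forall>x. \<exists>p :: 'n \<Rightarrow> 'n. bij p \<and> strict_mono ((\<lambda>i. e i x) \<circ> p)"
    using inj_real_sortable[OF inj] by blast
  then obtain p :: "'a \<Rightarrow> 'n \<Rightarrow> 'n" where p: "\<And>x. bij (p x)" "\<And>x. strict_mono ((\<lambda>i. e i x) \<circ> p x)" by metis
  define l where "l i x = e (p x i) x" for i x
  have l_mono: "strict_mono (\<lambda>i. l i x)" for x
    using p(2)[of x] by (simp add: l_def comp_def)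
  have "\<exists>u. eigenframe (A x) (\<lambda>i. l i x) u" for x
    using eigenframe_exists[OF sym lists_eigenvalues_permute[OF ev p(1)], of x x]
      strict_mono_imp_inj_on[OF p(2)] by (simp add: l_def comp_def)
  then obtain w where w: "\<And>x. eigenframe (A x) (\<lambda>i. l i x) (w x)" by metis
  interpret W: eigenframe_family A l "\<lambda>i x. w x i"
    by unfold_locales (use w l_mono in auto)
  have l_cont: "isCont (l i) x" for i x
    by (rule W.isCont_eigenvalue[OF A_cont])
  have "\<exists>v. continuous_on UNIV v \<and> (\<forall>x. v x = w x i \<or> v x = - w x i)" for i
  proof -
    obtain v where "continuous_on UNIV v" "\<And>x. x \<in> UNIV \<Longrightarrow> v x = w x i \<or> v x = - w x i"
    proof (rule unit_line_field_lift)
      show "simply_connected (UNIV :: 'a set)" by (simp add: convex_imp_simply_connected)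
      show "locally path_connected (UNIV :: 'a set)" by (simp add: convex_imp_locally_path_connected)
      show "norm (w x i) = 1" for x by (rule eigenframe_norm[OF w])
      show "continuous_on UNIV (\<lambda>x. (w x i \<bullet> a) *\<^sub>R w x i)" for a
        by (intro continuous_at_imp_continuous_on ballI W.isCont_eigenprojection A_cont)
    qed blast
    then show ?thesis by auto
  qed
  then obtain u where u_cont: "\<And>i. continuous_on UNIV (u i)"
    and u_sign: "\<And>i x. u i x = w x i \<or> u i x = - w x i" by metis
  have frame: "eigenframe (A x) (\<lambda>i. l i x) (\<lambda>i. u i x)" for x
  proof -
    have "u i x \<bullet> u j x = (if i = j then 1 else 0)" for i j
      using u_sign[of i x] u_sign[of j x] eigenframe_inner_frame[OF w[of x], of i j] by auto
    moreover have "A x *v u i x = l i x *\<^sub>R u i x" for i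
      using u_sign[of i x] eigenframe_eigen[OF w[of x], of i] by (auto simp: linear_neg)
    ultimately show ?thesis by (simp add: eigenframe_def)
  qed
  have "C1 (u i)" for i
  proof (rule C1I)
    show "(u i has_derivative (\<lambda>h. \<Sum>j\<in>UNIV - {i}.
        ((u j x \<bullet> (A' x h *v u i x)) / (l i x - l j x)) *\<^sub>R u j x)) (at x)" for x
      using u_cont
      by (intro eigenvector_has_derivative[OF frame _ A' l_cont] W.simple)
        (auto simp: continuous_on_eq_continuous_at)
    show "continuous_on UNIV (\<lambda>x. \<Sum>j\<in>UNIV - {i}.
        ((u j x \<bullet> (A' x h *v u i x)) / (l i x - l j x)) *\<^sub>R u j x)" for h
      using W.simple
      by (intro continuous_intros u_cont A'_cont bounded_bilinear.continuous_on[OF bounded_bilinear_matrix_vector_mult]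
          continuous_at_imp_continuous_on ballI l_cont) auto
  qed
  moreover have "continuous_on UNIV (l i)" for i
    by (simp add: continuous_at_imp_continuous_on l_cont)
  ultimately show ?thesis
    using frame p(1) by (intro exI[of _ l] exI[of _ u] exI[of _ p]) (auto simp: l_def bij_def)
qed

theorem proposition1p3:
  fixes eps mu :: "spacetime \<Rightarrow> real ^ 3 ^ 3"
    and e :: "3 \<Rightarrow> spacetime \<Rightarrow> real"
    and lam Lam :: real
  assumes mu: "\<And>x. mu x = mat 1"
    and eps_C1: "C1 eps"
    and eps_sym: "\<And>x. transpose (eps x) = eps x"
    and lam_pos: "lam > 0" and Lam_pos: "Lam > 0"
    and eps_lower: "\<And>x v. lam * (norm v)\<^sup>2 \<le> v \<bullet> (eps x *v v)"
    and eps_upper: "\<And>x v. v \<bullet> (eps x *v v) \<le> Lam * (norm v)\<^sup>2"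
    and eigenvalues: "\<And>x. lists_eigenvalues (\<lambda>i. e i x) (eps x)"
    and gap: "\<exists>c>0. \<forall>x i j. i \<noteq> j \<longrightarrow> \<bar>e i x - e j x\<bar> \<ge> c"
  shows "\<exists>(Phi :: spacetime \<Rightarrow> real ^ 3 ^ 3)
      (epsd :: 3 \<Rightarrow> spacetime \<Rightarrow> real) (mud :: 3 \<Rightarrow> spacetime \<Rightarrow> real).
    C1 Phi \<and>
    (\<forall>x. transpose (Phi x) ** Phi x = mat 1) \<and>
    continuous_on UNIV (\<lambda>x. diag_matrix (\<lambda>i. epsd i x)) \<and>
    continuous_on UNIV (\<lambda>x. diag_matrix (\<lambda>i. mud i x)) \<and>
    (\<forall>x. diag_matrix (\<lambda>i. epsd i x) = transpose (Phi x) ** eps x ** Phi x) \<and>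
    (\<forall>x. diag_matrix (\<lambda>i. mud i x) = transpose (Phi x) ** mu x ** Phi x) \<and>
    (\<exists>c'>0. \<forall>x i j. i \<noteq> j \<longrightarrow> \<bar>epsd i x / mud i x - epsd j x / mud j x\<bar> \<ge> c')"
proof -
  obtain c where c: "c > 0" "\<And>x i j. i \<noteq> j \<Longrightarrow> \<bar>e i x - e j x\<bar> \<ge> c"
    using gap by blast
  have inj: "inj (\<lambda>i. e i x)" for x
    using c by (intro injI) (metis abs_zero diff_self not_le)
  obtain l u p where frame: "\<And>x. eigenframe (eps x) (\<lambda>i. l i x) (\<lambda>i. u i x)"
    and p: "\<And>x. inj (p x)" "\<And>x i. l i x = e (p x i) x"
    and l: "\<And>i. continuous_on UNIV (l i)" and u: "\<And>i. C1 (u i)"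
    using C1_orthonormal_eigenframe[OF eps_C1 eps_sym eigenvalues inj] by metis
  define Phi where "Phi x = transpose (\<chi> i. u i x)" for x
  \<comment> \<open>The columns of \<open>Phi x\<close> are the eigenvectors, so conjugation computes \<open>M\<close> in the frame.\<close>
  have conj_entry: "(transpose (Phi x) ** M ** Phi x) $ i $ j = u i x \<bullet> (M *v u j x)" for x M i j
  proof -
    have "Phi x *v axis j 1 = u j x"
      by (simp add: Phi_def matrix_vector_mult_basis column_def transpose_def vec_eq_iff)
    then have "M *v u j x = (M ** Phi x) *v axis j 1"
      by (simp flip: matrix_vector_mul_assoc)
    moreover have "transpose (Phi x) ** M ** Phi x = transpose (Phi x) ** (M ** Phi x)"
      by (simp add: matrix_mul_assoc)
    ultimately show ?thesis
      by (simp add: matrix_vector_mult_basis column_def inner_vec_def)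
        (simp add: Phi_def matrix_matrix_mult_def)
  qed
  have gram: "transpose (Phi x) ** mat 1 ** Phi x = diag_matrix (\<lambda>i. 1)" for x
    by (simp only: vec_eq_iff conj_entry) (simp add: diag_matrix_def eigenframe_inner_frame[OF frame])
  show ?thesis
  proof (rule exI[of _ Phi], rule exI[of _ l], rule exI[of _ "\<lambda>i x. 1"], intro conjI allI)
    show "C1 Phi"
      unfolding Phi_def transpose_def vec_lambda_beta
      by (intro C1_vec_lambda C1_bounded_linear[OF bounded_linear_vec_nth] u)
    show "transpose (Phi x) ** Phi x = mat 1" for x
      using gram[of x] by (simp add: diag_matrix_def flip: mat_def)
    show "continuous_on UNIV (\<lambda>x. diag_matrix (\<lambda>i. l i x))"
    proof -
      have "continuous_on UNIV (\<lambda>x. if i = j then l i x else 0)" for i j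
        by (cases "i = j") (simp_all add: l)
      then show ?thesis
        unfolding diag_matrix_def by (intro continuous_on_vec_lambda)
    qed
    show "continuous_on UNIV (\<lambda>x :: spacetime. diag_matrix (\<lambda>i :: 3. 1))"
      by (rule continuous_on_const)
    show "diag_matrix (\<lambda>i. l i x) = transpose (Phi x) ** eps x ** Phi x" for x
      by (simp only: vec_eq_iff conj_entry)
        (simp add: diag_matrix_def eigenframe_inner_frame[OF frame] eigenframe_eigen[OF frame])
    show "diag_matrix (\<lambda>i. 1) = transpose (Phi x) ** mu x ** Phi x" for x
      by (simp only: mu gram)
    have "\<bar>l i x / 1 - l j x / 1\<bar> \<ge> c" if "i \<noteq> j" for i j x
      using c(2) p(1)[of x] that by (simp add: p(2) inj_eq)
    then show "\<exists>c'>0. \<forall>x i j. i \<noteq> j \<longrightarrow> \<bar>l i x / 1 - l j x / 1\<bar> \<ge> c'"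
      using c(1) by blast
  qed
qed

end
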